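(* Let $K$ be a field of characteristic zero. Let $p = \sum_{i=0}^n c_i x^{n-i} \in K[x]$ be a monic polynomial with exactly $k+1$ distinct roots, $r_0 = 0, r_1, r_2, \dots, r_k$, which are known, with multiplicity $m_0, m_1, m_2, \dots, m_k$, respectively. Then the multiplicities are uniquely determined by $c_0 = 1, c_1, \dots, c_k$.
   Context: The roots $r_0, \dots, r_k$ are all the roots of $p$ in an algebraic closure $\overline{K}$ of $K$. The coefficient $c_i$ of $x^{n-i}$ is the coefficient of codegree $i$, and $c_1, \dots, c_k$ are the first $k$ proper leading coefficients of $p$. *)

theory Defs
  imports "HOL-Algebra.Algebraic_Closure_Type" "HOL-Computational_Algebra.Polynomial"
begin

(* The coefficient c_i of x^(n - i) in a polynomial of degree n. The guard is needed because
   subtraction on nat truncates. *)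
definition codegree_coeff :: "'a::zero poly \<Rightarrow> nat \<Rightarrow> 'a" where
  "codegree_coeff p i =
     (if i \<le> Polynomial.degree p then Polynomial.coeff p (Polynomial.degree p - i) else 0)"

(* The pairwise distinct elements r 0, ..., r k are all the roots of p in the algebraic closure,
   and r i has multiplicity m i. The values of r and m beyond k are irrelevant. *)
definition has_distinct_roots ::
    "'a::field poly \<Rightarrow> nat \<Rightarrow> (nat \<Rightarrow> 'a alg_closure) \<Rightarrow> (nat \<Rightarrow> nat) \<Rightarrow> bool" where
  "has_distinct_roots p k r m \<longleftrightarrow>
     inj_on r {0..k} \<and>
     {x. poly (map_poly to_ac p) x = 0} = r ` {0..k} \<and>
     (\<forall>i\<in>{0..k}. Polynomial.order (r i) (map_poly to_ac p) = m i)"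

end

theory Submission
  imports Defs
begin

text \<open>
  Let \<open>P\<close> and \<open>Q\<close> be monic with the same distinct roots and put \<open>R = \<Prod>(x - r\<^sub>i)\<close>. Then
  \<open>P' R = P S\<close> with \<open>S = \<Sum> m\<^sub>i \<Prod>\<^bsub>j \<noteq> i\<^esub>(x - r\<^sub>j)\<close>, and likewise \<open>Q' R = Q T\<close>. With \<open>D = P - Q\<close> this gives
  \<open>Q (S - T) = D' R - D S\<close>. If the coefficients of codegree at most \<open>k\<close> agree, the right-hand
  side has degree less than \<open>n\<close>, so \<open>S = T\<close>, and evaluation at \<open>r\<^sub>i\<close> yields \<open>m\<^sub>i = m'\<^sub>i\<close>.
\<close>

text \<open>Multiplicities are attached to the roots rather than to indices, so that
  \<open>Polynomial.order\<close> can later be inserted for \<open>m\<close> directly.\<close>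

definition root_prod :: "'a::comm_ring_1 set \<Rightarrow> ('a \<Rightarrow> nat) \<Rightarrow> 'a poly" where
  "root_prod A m = (\<Prod>x\<in>A. [:-x, 1:] ^ m x)"

definition log_deriv_numerator :: "'a::comm_ring_1 set \<Rightarrow> ('a \<Rightarrow> nat) \<Rightarrow> 'a poly" where
  "log_deriv_numerator A m = (\<Sum>x\<in>A. smult (of_nat (m x)) (\<Prod>y\<in>A - {x}. [:-y, 1:]))"

lemma degree_root_prod:
  fixes A :: "'a::idom set"
  shows "Polynomial.degree (root_prod A m) = (\<Sum>x\<in>A. m x)"
  unfolding root_prod_def by (subst degree_prod_sum_eq) (auto simp: degree_linear_power)

lemma root_prod_nonzero:
  fixes A :: "'a::idom set"
  shows "root_prod A m \<noteq> 0"
  unfolding root_prod_def by (cases "finite A") auto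

lemma degree_linear_prod:
  fixes A :: "'a::idom set"
  shows "Polynomial.degree (\<Prod>x\<in>A. [:-x, 1:]) = card A"
  by (subst degree_prod_sum_eq) auto

lemma degree_log_deriv_numerator:
  fixes A :: "'a::idom set"
  assumes "finite A"
  shows "Polynomial.degree (log_deriv_numerator A m) \<le> card A - 1"
  unfolding log_deriv_numerator_def
proof (rule degree_sum_le[OF assms])
  fix x assume "x \<in> A"
  have "Polynomial.degree (smult (of_nat (m x)) (\<Prod>y\<in>A - {x}. [:-y, 1:]))
      \<le> Polynomial.degree (\<Prod>y\<in>A - {x}. [:-y, 1:])"
    by (rule degree_smult_le)
  also have "\<dots> = card A - 1"
    using \<open>x \<in> A\<close> assms by (simp add: degree_linear_prod)
  finally show "Polynomial.degree (smult (of_nat (m x)) (\<Prod>y\<in>A - {x}. [:-y, 1:])) \<le> card A - 1" .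
qed

text \<open>Every summand other than that of \<open>x\<close> contains the factor
  \<open>[:-x, 1:]\<close>. The values on \<open>A\<close> thus isolate the individual
  multiplicities.\<close>

lemma poly_log_deriv_numerator:
  fixes A :: "'a::idom set"
  assumes "finite A" "x \<in> A"
  shows "poly (log_deriv_numerator A m) x = of_nat (m x) * (\<Prod>y\<in>A - {x}. x - y)"
proof -
  have "poly (smult (of_nat (m z)) (\<Prod>y\<in>A - {z}. [:-y, 1:])) x = 0" if "z \<in> A - {x}" for z
    using that assms by (auto simp: poly_prod)
  then have "poly (log_deriv_numerator A m) x
      = poly (smult (of_nat (m x)) (\<Prod>y\<in>A - {x}. [:-y, 1:])) x"
    using assms unfolding log_deriv_numerator_def
    by (simp add: poly_sum sum.remove[of A x] del: poly_smult)
  then show ?thesis by (simp add: poly_prod)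
qed

text \<open>This is the logarithmic derivative P'/P = sum of m(x)/(X - x) with denominators cleared;
  by the product rule it can be checked one summand at a time.\<close>

lemma pderiv_root_prod:
  fixes A :: "'a::idom set"
  assumes "finite A"
  shows "pderiv (root_prod A m) * (\<Prod>x\<in>A. [:-x, 1:]) = root_prod A m * log_deriv_numerator A m"
proof -
  let ?L = "\<lambda>x::'a. [:-x, 1:]"
  have "(\<Prod>y\<in>A - {x}. ?L y ^ m y) * pderiv (?L x ^ m x) * prod ?L A
      = root_prod A m * smult (of_nat (m x)) (prod ?L (A - {x}))" if "x \<in> A" for x
  \<comment> \<open>The power rule lowers the exponent to \<open>m x - 1\<close>, which truncates at
    0; in that case both sides vanish.\<close>
  proof (cases "m x")
    case 0
    then show ?thesis by simp
  next
    case (Suc j)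
    have "root_prod A m = ?L x ^ Suc j * (\<Prod>y\<in>A - {x}. ?L y ^ m y)"
      unfolding root_prod_def using prod.remove[OF assms that, of "\<lambda>y. ?L y ^ m y"] Suc by simp
    moreover have "prod ?L A = ?L x * prod ?L (A - {x})"
      by (rule prod.remove[OF assms that])
    moreover have "pderiv (?L x) = 1"
      by (simp add: pderiv_pCons one_pCons)
    then have "pderiv (?L x ^ m x) = smult (of_nat (m x)) (?L x ^ j)"
      by (simp only: pderiv_power Suc diff_Suc_1 mult_1_right)
    ultimately show ?thesis
      by (simp only: mult_smult_left mult_smult_right power_Suc ac_simps)
  qed
  then show ?thesis
    by (simp only: root_prod_def[of A m, THEN arg_cong[of _ _ pderiv]] pderiv_prod sum_distrib_right
        log_deriv_numerator_def sum_distrib_left cong: sum.cong)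
qed

text \<open>The condition in \<open>coeffs\<close> covers the codegrees below \<open>card A\<close>,
  written without subtraction.\<close>

lemma multiplicities_eq_if_leading_coeffs_eq:
  fixes A :: "'a::field_char_0 set"
  assumes "finite A" and pos: "\<And>x. x \<in> A \<Longrightarrow> m x > 0"
    and deg: "(\<Sum>x\<in>A. m' x) = (\<Sum>x\<in>A. m x)"
    and coeffs: "\<And>i. (\<Sum>x\<in>A. m x) < i + card A
      \<Longrightarrow> Polynomial.coeff (root_prod A m) i = Polynomial.coeff (root_prod A m') i"
    and "x \<in> A"
  shows "m x = m' x"
proof -
  define n where "n = (\<Sum>x\<in>A. m x)"
  define R where "R = (\<Prod>x\<in>A. [:-x, 1:])"
  define P where "P = root_prod A m"
  define Q where "Q = root_prod A m'"
  define S where "S = log_deriv_numerator A m"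
  define T where "T = log_deriv_numerator A m'"
  define D where "D = P - Q"
  have "card A > 0" using assms by (auto simp: card_gt_0_iff)
  have "card A \<le> n"
    unfolding n_def using sum_mono[of A "\<lambda>_. 1" m] pos by (simp add: Suc_leI)
  have degS: "Polynomial.degree S \<le> card A - 1"
    unfolding S_def by (rule degree_log_deriv_numerator[OF \<open>finite A\<close>])
  have degR: "Polynomial.degree R = card A"
    unfolding R_def by (rule degree_linear_prod)
  have "pderiv P * R = P * S" "pderiv Q * R = Q * T"
    unfolding P_def Q_def R_def S_def T_def by (rule pderiv_root_prod[OF \<open>finite A\<close>])+
  then have eq: "Q * (S - T) = pderiv D * R - D * S"
    unfolding D_def pderiv_diff by (simp add: algebra_simps)
  \<comment> \<open>Otherwise \<open>coeffs\<close> would kill the leading coefficient of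
    \<open>D\<close>. For \<open>D = 0\<close> the degree is 0 by convention, and the bound rests on
    \<open>pos\<close> through \<open>card A \<le> n\<close>.\<close>
  have degD: "Polynomial.degree D + card A \<le> n"
  proof (cases "D = 0")
    case True
    then show ?thesis using \<open>card A \<le> n\<close> by simp
  next
    case False
    then have "Polynomial.coeff D (Polynomial.degree D) \<noteq> 0" by simp
    then show ?thesis
      using coeffs[of "Polynomial.degree D"] unfolding D_def P_def Q_def n_def by fastforce
  qed
  have "Polynomial.degree (pderiv D * R) < n"
  \<comment> \<open>Differentiation gains the one degree that makes the bound strict, except for
    constant \<open>D\<close>, where the product is zero and \<open>n > 0\<close> is needed.\<close>
  proof (cases "Polynomial.degree D = 0")
    case True
    then have "pderiv D = 0" by (simp add: pderiv_eq_0_iff)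
    then show ?thesis using \<open>card A > 0\<close> \<open>card A \<le> n\<close> by simp
  next
    case False
    then show ?thesis
      using degree_mult_le[of "pderiv D" R] degD degR by (simp add: degree_pderiv)
  qed
  moreover have "Polynomial.degree (D * S) < n"
    using degree_mult_le[of D S] degD degS \<open>card A > 0\<close> by linarith
  ultimately have small: "Polynomial.degree (Q * (S - T)) < n"
    unfolding eq by (rule degree_diff_less)
  have "S = T"
  proof (rule ccontr)
    assume "S \<noteq> T"
    \<comment> \<open>By \<open>deg\<close>, \<open>Q\<close> has degree \<open>n\<close> too, so a
      nonzero multiple of it cannot have degree below \<open>n\<close>.\<close>
    then have "Polynomial.degree (Q * (S - T)) = n + Polynomial.degree (S - T)"
      using degree_root_prod[of A m'] root_prod_nonzero[of A m'] deg
      by (simp add: degree_mult_eq Q_def n_def)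
    with small show False by simp
  qed
  then have "of_nat (m x) * (\<Prod>y\<in>A - {x}. x - y) = of_nat (m' x) * (\<Prod>y\<in>A - {x}. x - y)"
    unfolding S_def T_def using \<open>finite A\<close> \<open>x \<in> A\<close> by (metis poly_log_deriv_numerator)
  moreover have "(\<Prod>y\<in>A - {x}. x - y) \<noteq> 0"
    using \<open>finite A\<close> by auto
  \<comment> \<open>After cancelling the product, characteristic zero makes \<open>of_nat\<close>
    injective.\<close>
  ultimately show ?thesis by simp
qed

text \<open>Over an algebraically closed field a monic polynomial splits into linear factors; the
  multiset of these is \<open>proots p\<close>, which counts each root with its order.\<close>

lemma monic_eq_root_prod:
  fixes p :: "'a::alg_closed_field poly"
  assumes "lead_coeff p = 1"
  shows "p = root_prod {x. poly p x = 0} (\<lambda>x. Polynomial.order x p)"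
proof -
  have "p \<noteq> 0" using assms by auto
  obtain B where B: "p = (\<Prod>x\<in>#B. [:-x, 1:])"
    using alg_closed_imp_factorization[OF \<open>p \<noteq> 0\<close>] assms by auto
  have nonzero: "(\<Prod>x\<in>#C. [:-x, 1:]) \<noteq> (0 :: 'a poly)" for C
    by (induction C) (auto simp del: mult_pCons_left)
  have "proots p = B"
    unfolding B
  proof (induction B)
    case (add x B)
    have "proots ([:-x, 1:] * (\<Prod>y\<in>#B. [:-y, 1:])) = proots [:-x, 1:] + proots (\<Prod>y\<in>#B. [:-y, 1:])"
      by (rule proots_mult[OF _ nonzero]) simp
    then show ?case using add by (simp del: mult_pCons_left)
  qed simp
  then have "p = (\<Prod>x\<in>#proots p. [:-x, 1:])" using B by simp
  then show ?thesis
    using \<open>p \<noteq> 0\<close> by (simp add: image_prod_mset_multiplicity root_prod_def)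
qed

theorem theorem1p3:
  fixes p q :: "'a::field_char_0 poly"
    and n k :: nat
    and r :: "nat \<Rightarrow> 'a alg_closure"
    and m m' :: "nat \<Rightarrow> nat"
  assumes "r 0 = 0"
    and "Polynomial.degree p = n" and "lead_coeff p = 1" and "has_distinct_roots p k r m"
    and "Polynomial.degree q = n" and "lead_coeff q = 1" and "has_distinct_roots q k r m'"
    and "\<forall>i\<in>{0..k}. codegree_coeff p i = codegree_coeff q i"
  shows "\<forall>i\<in>{0..k}. m i = m' i"
proof
  fix i assume i: "i \<in> {0..k}"
  define P where "P = map_poly to_ac p"
  define Q where "Q = map_poly to_ac q"
  define A where "A = r ` {0..k}"
  have degs: "Polynomial.degree P = n" "Polynomial.degree Q = n"
    using assms by (simp_all add: P_def Q_def degree_map_poly)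
  have monic: "lead_coeff P = 1" "lead_coeff Q = 1"
    using assms degs by (simp_all add: P_def Q_def coeff_map_poly)
  have roots: "{x. poly P x = 0} = A" "{x. poly Q x = 0} = A"
    using assms by (simp_all add: has_distinct_roots_def P_def Q_def A_def)
  have P: "P = root_prod A (\<lambda>x. Polynomial.order x P)"
    and Q: "Q = root_prod A (\<lambda>x. Polynomial.order x Q)"
    using monic_eq_root_prod[OF monic(1)] monic_eq_root_prod[OF monic(2)] roots by simp_all
  have sums: "(\<Sum>x\<in>A. Polynomial.order x P) = n" "(\<Sum>x\<in>A. Polynomial.order x Q) = n"
    using degs P Q degree_root_prod by metis+
  have card: "card A = Suc k"
    using assms by (simp add: has_distinct_roots_def A_def card_image)
  have coeffs: "Polynomial.coeff P j = Polynomial.coeff Q j" if "n < j + card A" for j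
  \<comment> \<open>With \<open>card A = k + 1\<close>, index \<open>j\<close> has codegree
    \<open>n - j \<le> k\<close>. The subtraction is only meaningful for \<open>j \<le> n\<close>;
    beyond that both coefficients vanish.\<close>
  proof (cases "j \<le> n")
    case True
    then have "codegree_coeff p (n - j) = codegree_coeff q (n - j)"
      using that card assms by auto
    then show ?thesis
      using True assms by (simp add: codegree_coeff_def P_def Q_def coeff_map_poly)
  next
    case False
    then show ?thesis using degs by (simp add: coeff_eq_0)
  qed
  have "Polynomial.order (r i) P = Polynomial.order (r i) Q"
  proof (rule multiplicities_eq_if_leading_coeffs_eq[of A])
    show "Polynomial.order x P > 0" if "x \<in> A" for x
      using that roots(1) monic(1) order_root[of P x] by auto
  qed (use i sums coeffs P Q in \<open>auto simp: A_def\<close>)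
  then show "m i = m' i"
    using assms i by (simp add: has_distinct_roots_def P_def Q_def)
qed

end
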